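(* Let $D\subseteq\mathbb{R}^2$ be open, let $u:D\to\mathbb{R}$ be a twice continuously differentiable function, and let $f:D\to\mathbb{R}^3$, $f(x,y)=\langle x,y,u(x,y)\rangle$, be the corresponding surface patch in graph form. Let $p=(x,y)\in D$ be a point such that the tangent plane to the surface at $f(p)$ does not pass through the origin $O(0,0,0)$. Let $K_f(p)$ be the Gaussian curvature of the surface at $f(p)$ and let $d_f(p)$ be the Euclidean distance from the origin to the tangent plane to the surface at $f(p)$. Let $V_x$, $V_y$, $V_{xy}$, $V$ be the oriented volumes of the parallelepipeds determined respectively by the ordered triples of vectors $$\left(\frac{\partial^2 f}{\partial x^2},\frac{\partial f}{\partial x},\frac{\partial f}{\partial y}\right),\quad \left(\frac{\partial^2 f}{\partial y^2},\frac{\partial f}{\partial x},\frac{\partial f}{\partial y}\right),\quad \left(\frac{\partial^2 f}{\partial x\,\partial y},\frac{\partial f}{\partial x},\frac{\partial f}{\partial y}\right),\quad \left(f,\frac{\partial f}{\partial x},\frac{\partial f}{\partial y}\right),$$ all evaluated at $p$. Then $$\frac{K_f(p)}{d_f(p)^4}=\frac{V_xV_y-(V_{xy})^2}{V^4}.$$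
   Context: The oriented volume of the parallelepiped determined by an ordered triple of vectors $(a,b,c)$ in $\mathbb{R}^3$ is the determinant of the $3\times 3$ matrix whose rows are $a,b,c$, in this order. Explicitly, at $p=(x,y)$, $$V_x=\begin{vmatrix}0&0&\frac{\partial^2u}{\partial x^2}\\ 1&0&\frac{\partial u}{\partial x}\\ 0&1&\frac{\partial u}{\partial y}\end{vmatrix},\quad V_y=\begin{vmatrix}0&0&\frac{\partial^2u}{\partial y^2}\\ 1&0&\frac{\partial u}{\partial x}\\ 0&1&\frac{\partial u}{\partial y}\end{vmatrix},\quad V_{xy}=\begin{vmatrix}0&0&\frac{\partial^2u}{\partial x\partial y}\\ 1&0&\frac{\partial u}{\partial x}\\ 0&1&\frac{\partial u}{\partial y}\end{vmatrix},\quad V=\begin{vmatrix}x&y&u(x,y)\\ 1&0&\frac{\partial u}{\partial x}\\ 0&1&\frac{\partial u}{\partial y}\end{vmatrix}.$$ The Gaussian curvature of the graph at $f(p)$ is $$K_f(p)=\frac{\frac{\partial^2 u}{\partial x^2}\frac{\partial^2 u}{\partial y^2}-\left(\frac{\partial^2 u}{\partial x\partial y}\right)^2}{\left[\left(\frac{\partial u}{\partial x}\right)^2+\left(\frac{\partial u}{\partial y}\right)^2+1\right]^2},$$ and the distance from the origin to the tangent plane at $f(p)$ is $$d_f(p)=\frac{\left|x\frac{\partial u}{\partial x}+y\frac{\partial u}{\partial y}-u(x,y)\right|}{\sqrt{\left(\frac{\partial u}{\partial x}\right)^2+\left(\frac{\partial u}{\partial y}\right)^2+1}},$$ with all derivatives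 evaluated at $p$. *)

theory Defs
  imports "HOL-Analysis.Analysis"
begin

text \<open>
  The index type \<open>2\<close> has exactly the two elements \<open>1\<close> and \<open>2\<close> (where \<open>2 = 0\<close>); the coordinates
  of \<open>p :: real ^ 2\<close> are \<open>x = p $ 1\<close> and \<open>y = p $ 2\<close>.
\<close>

definition partial :: "2 \<Rightarrow> (real ^ 2 \<Rightarrow> 'a::real_normed_vector) \<Rightarrow> real ^ 2 \<Rightarrow> 'a" where
  "partial i g p = vector_derivative (\<lambda>t. g (p + t *\<^sub>R axis i 1)) (at 0)"

definition C1_on :: "(real ^ 2) set \<Rightarrow> (real ^ 2 \<Rightarrow> 'a::real_normed_vector) \<Rightarrow> bool" where
  "C1_on D g \<longleftrightarrow>
     (\<forall>i. (\<forall>p\<in>D. (\<lambda>t. g (p + t *\<^sub>R axis i 1)) differentiable (at 0)) \<and>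
          continuous_on D (partial i g))"

definition C2_on :: "(real ^ 2) set \<Rightarrow> (real ^ 2 \<Rightarrow> 'a::real_normed_vector) \<Rightarrow> bool" where
  "C2_on D g \<longleftrightarrow> C1_on D g \<and> (\<forall>i. C1_on D (partial i g))"

definition graph_patch :: "(real ^ 2 \<Rightarrow> real) \<Rightarrow> real ^ 2 \<Rightarrow> real ^ 3" where
  "graph_patch u p = vector [p $ 1, p $ 2, u p]"

definition unit_normal :: "(real ^ 2 \<Rightarrow> real ^ 3) \<Rightarrow> real ^ 2 \<Rightarrow> real ^ 3" where
  "unit_normal f p = sgn (cross3 (partial 1 f p) (partial 2 f p))"

text \<open>
  \<open>(L N - M\<^sup>2) / (E G - F\<^sup>2)\<close>, the quotient of the determinants of the second and the first
  fundamental form.  For \<open>f = graph_patch u\<close> it equals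
  \<open>(u\<^sub>x\<^sub>x u\<^sub>y\<^sub>y - u\<^sub>x\<^sub>y\<^sup>2) / (u\<^sub>x\<^sup>2 + u\<^sub>y\<^sup>2 + 1)\<^sup>2\<close>.
\<close>
definition gauss_curvature :: "(real ^ 2 \<Rightarrow> real ^ 3) \<Rightarrow> real ^ 2 \<Rightarrow> real" where
  "gauss_curvature f p =
     ((partial 1 (partial 1 f) p \<bullet> unit_normal f p) * (partial 2 (partial 2 f) p \<bullet> unit_normal f p)
        - (partial 1 (partial 2 f) p \<bullet> unit_normal f p)\<^sup>2) /
     ((partial 1 f p \<bullet> partial 1 f p) * (partial 2 f p \<bullet> partial 2 f p)
        - (partial 1 f p \<bullet> partial 2 f p)\<^sup>2)"

definition tangent_plane :: "(real ^ 2 \<Rightarrow> real ^ 3) \<Rightarrow> real ^ 2 \<Rightarrow> (real ^ 3) set" where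
  "tangent_plane f p = {f p + s *\<^sub>R partial 1 f p + t *\<^sub>R partial 2 f p | s t. True}"

definition origin_dist :: "(real ^ 2 \<Rightarrow> real ^ 3) \<Rightarrow> real ^ 2 \<Rightarrow> real" where
  "origin_dist f p = infdist 0 (tangent_plane f p)"

text \<open>The vectors \<open>a\<close>, \<open>b\<close>, \<open>c\<close> are the rows of the matrix.\<close>
definition oriented_volume :: "real ^ 3 \<Rightarrow> real ^ 3 \<Rightarrow> real ^ 3 \<Rightarrow> real" where
  "oriented_volume a b c = det (vector [a, b, c] :: real ^ 3 ^ 3)"

end

theory Submission
  imports Defs
begin

text \<open>
  With \<open>n = a \<times> b\<close> for the two tangent vectors \<open>a\<close>, \<open>b\<close>, each oriented volume is an inner product
  with \<open>n\<close>. As \<open>EG - F\<^sup>2 = \<bar>n\<bar>\<^sup>2\<close>, the curvature is \<open>(Vx Vy - Vxy\<^sup>2) / \<bar>n\<bar>\<^sup>4\<close>, and the distance is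
  \<open>\<bar>V\<bar> / \<bar>n\<bar>\<close>, so the powers of \<open>\<bar>n\<bar>\<close> cancel.
\<close>

lemma oriented_volume_eq_inner: "oriented_volume c a b = c \<bullet> cross3 a b"
  by (simp add: oriented_volume_def dot_cross_det)

text \<open>Cramer's rule for the coordinates of \<open>w\<close> along \<open>a\<close>,
  \<open>b\<close> and their cross product: the Gram determinant of \<open>a\<close>,
  \<open>b\<close> is the squared norm of that product. Clearing this denominator keeps the identity
  valid for dependent \<open>a\<close>, \<open>b\<close>.\<close>

lemma scaleR_norm_cross3_decomposition:
  "(norm (cross3 a b))\<^sup>2 *\<^sub>R w =
     (w \<bullet> cross3 a b) *\<^sub>R cross3 a b
     + ((w \<bullet> a) * (b \<bullet> b) - (w \<bullet> b) * (a \<bullet> b)) *\<^sub>R a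
     + ((w \<bullet> b) * (a \<bullet> a) - (w \<bullet> a) * (a \<bullet> b)) *\<^sub>R b"
  unfolding power2_norm_eq_inner
  by (simp add: cross3_def vec_eq_iff forall_3 inner_vec_def sum_3 algebra_simps)

lemma infdist_zero_plane:
  fixes a b c :: "real ^ 3"
  assumes "cross3 a b \<noteq> 0"
  shows "infdist 0 {c + s *\<^sub>R a + t *\<^sub>R b | s t. True}
           = \<bar>c \<bullet> cross3 a b\<bar> / norm (cross3 a b)" (is "infdist 0 ?P = _ / norm ?n")
proof (rule antisym)
  \<comment> \<open>The foot of the perpendicular from the origin: the projection of
    \<open>c\<close> onto the normal line. The decomposition of \<open>c\<close> places it in the
    plane.\<close>
  define q where "q = (c \<bullet> ?n / (norm ?n)\<^sup>2) *\<^sub>R ?n"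
  let ?S = "(c \<bullet> a) * (b \<bullet> b) - (c \<bullet> b) * (a \<bullet> b)"
  let ?T = "(c \<bullet> b) * (a \<bullet> a) - (c \<bullet> a) * (a \<bullet> b)"
  have n: "norm ?n > 0"
    using assms by simp
  have "c = (1 / (norm ?n)\<^sup>2) *\<^sub>R ((norm ?n)\<^sup>2 *\<^sub>R c)"
    using n by simp
  also have "\<dots> = q + (?S / (norm ?n)\<^sup>2) *\<^sub>R a + (?T / (norm ?n)\<^sup>2) *\<^sub>R b"
    unfolding scaleR_norm_cross3_decomposition q_def by (simp add: scaleR_right_distrib)
  finally have "q = c - (?T / (norm ?n)\<^sup>2) *\<^sub>R b - (?S / (norm ?n)\<^sup>2) *\<^sub>R a"
    by (metis add_diff_cancel_right')
  then have "q = c + (- (?S / (norm ?n)\<^sup>2)) *\<^sub>R a + (- (?T / (norm ?n)\<^sup>2)) *\<^sub>R b"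
    by (simp only: scaleR_minus_left) simp
  then have "q \<in> ?P"
    by blast
  then have "infdist 0 ?P \<le> norm q"
    using infdist_le[of q ?P 0] by simp
  also have "norm q = \<bar>c \<bullet> ?n\<bar> / norm ?n"
    by (simp add: q_def power2_eq_square)
  finally show "infdist 0 ?P \<le> \<bar>c \<bullet> ?n\<bar> / norm ?n" .
  have "\<bar>c \<bullet> ?n\<bar> / norm ?n \<le> dist 0 r" if "r \<in> ?P" for r
  proof -
    \<comment> \<open>Both spanning vectors are orthogonal to the normal, so the inner product with
      it is constant on the plane.\<close>
    have "c \<bullet> ?n = r \<bullet> ?n"
      using that by (auto simp: inner_left_distrib dot_cross_self)
    then have "\<bar>c \<bullet> ?n\<bar> \<le> norm r * norm ?n"
      by (simp add: Cauchy_Schwarz_ineq2)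
    then show ?thesis
      using n by (simp add: divide_le_eq)
  qed
  moreover have "?P \<noteq> {}"
    by blast
  ultimately show "\<bar>c \<bullet> ?n\<bar> / norm ?n \<le> infdist 0 ?P"
    unfolding infdist_notempty[OF \<open>?P \<noteq> {}\<close>] by (intro cINF_greatest)
qed

lemma gauss_curvature_eq_oriented_volume:
  fixes f :: "real ^ 2 \<Rightarrow> real ^ 3"
  defines "vol w p \<equiv> oriented_volume w (partial 1 f p) (partial 2 f p)"
  shows "gauss_curvature f p =
    (vol (partial 1 (partial 1 f) p) p * vol (partial 2 (partial 2 f) p) p
       - (vol (partial 1 (partial 2 f) p) p)\<^sup>2)
    / norm (cross3 (partial 1 f p) (partial 2 f p)) ^ 4"
proof -
  define n where "n = cross3 (partial 1 f p) (partial 2 f p)"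
  \<comment> \<open>If \<open>n = 0\<close>, both sides vanish because \<open>sgn 0 = 0\<close> and
    \<open>x / 0 = 0\<close>.\<close>
  have vol: "w \<bullet> unit_normal f p = vol w p / norm n" for w
    by (simp add: unit_normal_def vol_def oriented_volume_eq_inner sgn_div_norm n_def
        divide_inverse mult.commute)
  \<comment> \<open>Lagrange's identity.\<close>
  have EG_F: "(partial 1 f p \<bullet> partial 1 f p) * (partial 2 f p \<bullet> partial 2 f p)
      - (partial 1 f p \<bullet> partial 2 f p)\<^sup>2 = (norm n)\<^sup>2"
    by (simp add: n_def norm_cross power2_norm_eq_inner[symmetric])
  \<comment> \<open>One factor \<open>(norm n)\<^sup>2\<close> comes from the two unit normals in
    each product, the other from the first fundamental form.\<close>
  have "gauss_curvature f p =
    (vol (partial 1 (partial 1 f) p) p * vol (partial 2 (partial 2 f) p) p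
       - (vol (partial 1 (partial 2 f) p) p)\<^sup>2) / (norm n)\<^sup>2 / (norm n)\<^sup>2"
    unfolding gauss_curvature_def vol EG_F
    by (simp add: power2_eq_square diff_divide_distrib)
  then show ?thesis
    by (simp add: n_def power_add[symmetric])
qed

theorem mainTheorem1:
  fixes D :: "(real ^ 2) set" and u :: "real ^ 2 \<Rightarrow> real"
    and f :: "real ^ 2 \<Rightarrow> real ^ 3" and p :: "real ^ 2"
    and Vx Vy Vxy V :: real
  assumes "open D"
    and "C2_on D u"
    and "f = graph_patch u"
    and "p \<in> D"
    and "0 \<notin> tangent_plane f p"
    and "Vx = oriented_volume (partial 1 (partial 1 f) p) (partial 1 f p) (partial 2 f p)"
    and "Vy = oriented_volume (partial 2 (partial 2 f) p) (partial 1 f p) (partial 2 f p)"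
    and "Vxy = oriented_volume (partial 1 (partial 2 f) p) (partial 1 f p) (partial 2 f p)"
    and "V = oriented_volume (f p) (partial 1 f p) (partial 2 f p)"
  shows "gauss_curvature f p / origin_dist f p ^ 4 = (Vx * Vy - Vxy\<^sup>2) / V ^ 4"
proof (cases "cross3 (partial 1 f p) (partial 2 f p) = 0")
  \<comment> \<open>Impossible for a graph, but harmless: both sides are then \<open>0\<close> since \<open>x / 0 = 0\<close>.\<close>
  case True
  then show ?thesis
    using assms(6-9) by (simp add: gauss_curvature_eq_oriented_volume oriented_volume_eq_inner)
next
  case False
  let ?n = "norm (cross3 (partial 1 f p) (partial 2 f p))"
  have "origin_dist f p ^ 4 = (\<bar>V\<bar> / ?n) ^ 4"
    using infdist_zero_plane[OF False] assms(9)
    by (simp add: origin_dist_def tangent_plane_def oriented_volume_eq_inner)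
  \<comment> \<open>The even power removes the absolute value, so the sign of \<open>V\<close> is
    immaterial.\<close>
  also have "\<dots> = V ^ 4 / ?n ^ 4"
    by (simp add: power_divide)
  finally show ?thesis
    using False assms(6-8) by (simp add: gauss_curvature_eq_oriented_volume)
qed

end
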